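(* A graph signal $\mathbf{x}\in\mathbb{C}^{N}$ is perfectly localized, meaning that it is simultaneously bandlimited over the pair $(\mathcal{S},\mathcal{F})$ so that $\mathbf{x}\in\mathcal{D}\cap\mathcal{B}^{\alpha}$, if and only if $$\|\mathbf{B}^{\alpha}\mathbf{D}\|_2=\|\mathbf{D}\mathbf{B}^{\alpha}\|_2=1.$$
   Context: Let $\mathcal{G}$ be an undirected weighted graph with vertex set $\mathcal{V}$, $|\mathcal{V}|=N$. A graph signal is a vector $\mathbf{x}\in\mathbb{C}^N$ whose entries are indexed by the vertices. The graph shift operator $\mathbf{S}$ is a symmetric $N\times N$ matrix (e.g. the adjacency matrix or the graph Laplacian) with eigendecomposition $\mathbf{S}=\mathbf{U}\boldsymbol{\Delta}\mathbf{U}^{\mathrm H}$, where $\boldsymbol{\Delta}$ is the diagonal matrix of eigenvalues $0\le\delta_0\le\cdots\le\delta_{N-1}$ and $\mathbf{U}$ is unitary with the eigenvectors as columns. The graph Fourier transform matrix is $\mathbf{F}=\mathbf{U}^{\mathrm H}$, with spectral decomposition $\mathbf{U}^{\mathrm H}=\mathbf{Q}\boldsymbol{\Lambda}\mathbf{Q}^{\mathrm H}$, where $\boldsymbol{\Lambda}$ is diagonal. For $\alpha\in\mathbb{R}$, the graph fractional Fourier transform (GFRFT) matrix of order $\alpha$ is $\mathbf{F}^{\alpha}=\mathbf{Q}\boldsymbol{\Lambda}^{\alpha}\mathbf{Q}^{\mathrm H}$, where $\boldsymbol{\Lambda}^{\alpha}$ is obtained by raising each diagonal entry of $\boldsymbol{\Lambda}$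 to the power $\alpha$, and the inverse GFRFT matrix is $\mathbf{F}^{-\alpha}=\mathbf{Q}\boldsymbol{\Lambda}^{-\alpha}\mathbf{Q}^{\mathrm H}$. For a vertex subset $\mathcal{S}\subseteq\mathcal{V}$, the vertex-limiting operator is $\mathbf{D}=\mathbf{D}_{\mathcal{S}}=\mathrm{diag}(\mathbf{1}_{\mathcal{S}})$, where $\mathbf{1}_{\mathcal{S}}$ is the indicator vector of $\mathcal{S}$. For a frequency-index subset $\mathcal{F}\subseteq\{1,\dots,N\}$, the fractional spectral-limiting operator is $\mathbf{B}^{\alpha}=\mathbf{B}^{\alpha}_{\mathcal{F}}=\mathbf{F}^{-\alpha}\boldsymbol{\Sigma}_{\mathcal{F}}\mathbf{F}^{\alpha}$ with $\boldsymbol{\Sigma}_{\mathcal{F}}=\mathrm{diag}(\mathbf{1}_{\mathcal{F}})$, where $\mathbf{1}_{\mathcal{F}}$ is the indicator vector of $\mathcal{F}$. Both $\mathbf{D}$ and $\mathbf{B}^{\alpha}$ are Hermitian and idempotent, i.e. orthogonal projections. $\mathcal{D}$ denotes the set of vertex-limited signals, those satisfying $\mathbf{D}\mathbf{x}=\mathbf{x}$, and $\mathcal{B}^{\alpha}$ the set of graph fractional bandlimited signals, those satisfying $\mathbf{B}^{\alpha}\mathbf{x}=\mathbf{x}$. $\|\cdot\|_2$ of a matrix is the spectral norm.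
   Formalization: The claim fails for an individual signal x (x = 0 is always perfectly localized, and the norm condition does not involve x), so it is stated as: a nonzero perfectly localized signal over (S, F) exists if and only if both norms equal 1. *)

theory Defs
  imports "HOL-Analysis.Analysis"
begin

text \<open>The index type \<open>'n\<close> plays the role of both the vertex set and the index set
  \<open>{1..N}\<close> of the frequencies, with \<open>N = CARD('n)\<close>. Its linear order is used only to
  list the eigenvalues of the shift operator in ascending order.\<close>

definition conj_transpose :: "complex^'n^'m \<Rightarrow> complex^'m^'n" where
  "conj_transpose A = map_matrix cnj (transpose A)"

definition unitary_matrix :: "complex^'n^'n \<Rightarrow> bool" where
  "unitary_matrix A \<longleftrightarrow> conj_transpose A ** A = mat 1 \<and> A ** conj_transpose A = mat 1"

definition diag_matrix :: "('n \<Rightarrow> complex) \<Rightarrow> complex^'n^'n" where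
  "diag_matrix d = (\<chi> i j. if i = j then d i else 0)"

text \<open>The graph enters only through its shift operator \<open>S\<close>, an arbitrary symmetric matrix.
  The columns of \<open>U\<close> are eigenvectors of \<open>S\<close> for the ascending eigenvalues \<open>\<delta>\<close>.\<close>

definition shift_eigendecomposition ::
    "complex^('n::{finite,linorder})^('n::{finite,linorder}) \<Rightarrow> complex^('n::{finite,linorder})^('n::{finite,linorder})
      \<Rightarrow> ('n \<Rightarrow> real) \<Rightarrow> bool" where
  "shift_eigendecomposition S U \<delta> \<longleftrightarrow>
     transpose S = S \<and> unitary_matrix U \<and> mono \<delta> \<and> (\<forall>i. 0 \<le> \<delta> i) \<and>
     S = U ** diag_matrix (\<lambda>i. complex_of_real (\<delta> i)) ** conj_transpose U"

definition unitary_diagonalization ::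
    "complex^'n^'n \<Rightarrow> complex^'n^'n \<Rightarrow> ('n \<Rightarrow> complex) \<Rightarrow> bool" where
  "unitary_diagonalization A Q l \<longleftrightarrow>
     unitary_matrix Q \<and> A = Q ** diag_matrix l ** conj_transpose Q"

text \<open>The fractional power of order \<open>\<alpha>\<close> of \<open>F = Q \<Lambda> Q\<^sup>H\<close>, where \<open>\<Lambda> = diag_matrix l\<close>.
  Powers of the complex numbers \<open>l i\<close> are principal values, as given by \<open>powr\<close>.
  The inverse transform is the power of order \<open>-\<alpha>\<close>.\<close>

definition gfrft :: "complex^'n^'n \<Rightarrow> ('n \<Rightarrow> complex) \<Rightarrow> real \<Rightarrow> complex^'n^'n" where
  "gfrft Q l \<alpha> = Q ** diag_matrix (\<lambda>i. l i powr complex_of_real \<alpha>) ** conj_transpose Q"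

definition vertex_limiting :: "'n set \<Rightarrow> complex^'n^'n" where
  "vertex_limiting V = diag_matrix (indicator V)"

definition spectral_limiting ::
    "complex^'n^'n \<Rightarrow> ('n \<Rightarrow> complex) \<Rightarrow> real \<Rightarrow> 'n set \<Rightarrow> complex^'n^'n" where
  "spectral_limiting Q l \<alpha> W =
     gfrft Q l (- \<alpha>) ** diag_matrix (indicator W) ** gfrft Q l \<alpha>"

definition vertex_limited_signals :: "'n set \<Rightarrow> (complex^'n) set" where
  "vertex_limited_signals V = {x. vertex_limiting V *v x = x}"

definition bandlimited_signals ::
    "complex^'n^'n \<Rightarrow> ('n \<Rightarrow> complex) \<Rightarrow> real \<Rightarrow> 'n set \<Rightarrow> (complex^'n) set" where
  "bandlimited_signals Q l \<alpha> W = {x. spectral_limiting Q l \<alpha> W *v x = x}"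

definition perfectly_localized ::
    "complex^'n^'n \<Rightarrow> ('n \<Rightarrow> complex) \<Rightarrow> real \<Rightarrow> 'n set \<Rightarrow> 'n set \<Rightarrow> complex^'n \<Rightarrow> bool" where
  "perfectly_localized Q l \<alpha> V W x \<longleftrightarrow>
     x \<in> vertex_limited_signals V \<inter> bandlimited_signals Q l \<alpha> W"

text \<open>The norm on \<^typ>\<open>complex^'n\<close> is the Euclidean one, so its operator norm is the spectral norm.\<close>

definition spectral_norm :: "complex^'n^'m \<Rightarrow> real" where
  "spectral_norm A = onorm (\<lambda>x. A *v x)"

end

theory Submission
  imports Defs
begin

text \<open>
  The vertex-limiting operator \<open>D\<close> and the spectral-limiting operator \<open>B\<close> are both orthogonal
  projections, and the theorem is a fact about any two orthogonal projections \<open>P\<close> and \<open>R\<close> of a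
  Euclidean space: \<open>P \<circ> R\<close> has operator norm \<open>1\<close> exactly if \<open>P\<close> and \<open>R\<close> share a nonzero fixed
  vector (lemma \<open>onorm_comp_orth_projections_eq_1_iff\<close>). A projection never increases the norm,
  and by Pythagoras it preserves the norm of its fixed vectors only. In finite dimension the
  operator norm is attained at a unit vector \<open>x\<close>. If it is \<open>1\<close>, then
  \<open>1 = \<parallel>P (R x)\<parallel> \<le> \<parallel>R x\<parallel> \<le> \<parallel>x\<parallel> = 1\<close>, which forces \<open>R x = x\<close> and then \<open>P x = x\<close>. Conversely
  a common fixed vector shows that the norm, which is at most \<open>1\<close>, equals \<open>1\<close>. The
  condition is symmetric in \<open>P\<close> and \<open>R\<close>, so one of the two products has norm \<open>1\<close>
  exactly if the other has.

  That \<open>B\<close> is an orthogonal projection comes from the unitarity of the graph Fourier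
  transform: its eigenvalues lie on the unit circle, where real powers have modulus \<open>1\<close> and
  the power of order \<open>-\<alpha>\<close> is the complex conjugate of the power of order \<open>\<alpha>\<close>. Hence the
  fractional transform \<open>G\<close> of order \<open>\<alpha>\<close> is unitary, its inverse of order \<open>-\<alpha>\<close> is \<open>G\<^sup>H\<close>, and
  \<open>B = G\<^sup>H \<Sigma> G\<close> is unitarily equivalent to a coordinate projection.

  All metric arguments use the real inner product \<open>Re (\<Sum>i. x\<^sub>i * cnj y\<^sub>i)\<close> on complex vectors.
  It induces the same Euclidean norm as the Hermitian one, and the conjugate transpose is the
  adjoint for it as well.
\<close>

section \<open>Products of two orthogonal projections\<close>

definition orth_projection :: "('a::real_inner \<Rightarrow> 'a) \<Rightarrow> bool" where
  "orth_projection P \<longleftrightarrow>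
     linear P \<and> (\<forall>x. P (P x) = P x) \<and> (\<forall>x y. P x \<bullet> y = x \<bullet> P y)"

lemma orth_projection_pythagoras:
  assumes "orth_projection P"
  shows "(norm x)\<^sup>2 = (norm (P x))\<^sup>2 + (norm (x - P x))\<^sup>2"
proof -
  have "P x \<bullet> P x = x \<bullet> P (P x)" and "P (P x) = P x"
    using assms unfolding orth_projection_def by blast+
  then have "P x \<bullet> P x = x \<bullet> P x"
    by metis
  moreover have "(x - P x) \<bullet> (x - P x) = x \<bullet> x - 2 * (x \<bullet> P x) + P x \<bullet> P x"
    using inner_commute[of "P x" x] by (simp only: inner_diff_left inner_diff_right)
  ultimately show ?thesis
    unfolding power2_norm_eq_inner by linarith
qed

lemma orth_projection_norm_le:
  assumes "orth_projection P"
  shows "norm (P x) \<le> norm x"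
proof (rule power2_le_imp_le)
  show "(norm (P x))\<^sup>2 \<le> (norm x)\<^sup>2"
    unfolding orth_projection_pythagoras[OF assms, of x] by simp
qed simp

lemma orth_projection_norm_eq_imp_fixed:
  assumes "orth_projection P" and "norm (P x) = norm x"
  shows "P x = x"
proof -
  have "(norm (x - P x))\<^sup>2 = 0"
    using orth_projection_pythagoras[OF assms(1), of x] unfolding assms(2) by linarith
  then show ?thesis
    by simp
qed

text \<open>The unit sphere is compact, so the supremum defining the operator norm is a maximum.\<close>

lemma onorm_attained:
  fixes f :: "'a::euclidean_space \<Rightarrow> 'b::real_normed_vector"
  assumes "bounded_linear f"
  obtains x where "norm x = 1" and "norm (f x) = onorm f"
proof -
  interpret bounded_linear f by fact
  have "continuous_on (sphere 0 1) (\<lambda>x. norm (f x))"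
    by (intro continuous_on_norm linear_continuous_on assms)
  moreover have "sphere (0::'a) 1 \<noteq> {}"
    by simp
  ultimately obtain x where "x \<in> sphere 0 1"
      and "\<forall>y\<in>sphere 0 1. norm (f y) \<le> norm (f x)"
    using continuous_attains_sup[OF compact_sphere] by blast
  then have x: "norm x = 1" and max: "\<And>y. norm y = 1 \<Longrightarrow> norm (f y) \<le> norm (f x)"
    by simp_all
  have "norm (f y) \<le> norm (f x) * norm y" for y
  proof (cases "y = 0")
    case False
    then have "norm (f (y /\<^sub>R norm y)) \<le> norm (f x)"
      by (intro max) simp
    then show ?thesis
      using False by (simp add: scaleR field_simps)
  qed (simp add: zero)
  then have "onorm f \<le> norm (f x)"
    by (intro onorm_bound) auto
  moreover have "norm (f x) \<le> onorm f"
    using onorm[OF assms, of x] x by simp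
  ultimately show ?thesis
    using that x by simp
qed

lemma onorm_comp_orth_projections_eq_1_iff:
  fixes P R :: "'a::euclidean_space \<Rightarrow> 'a"
  assumes P: "orth_projection P" and R: "orth_projection R"
  shows "onorm (\<lambda>x. P (R x)) = 1 \<longleftrightarrow> (\<exists>x. x \<noteq> 0 \<and> P x = x \<and> R x = x)"
proof -
  have "linear P" "linear R"
    using P R by (auto simp: orth_projection_def)
  then have lin: "bounded_linear (\<lambda>x. P (R x))"
    using linear_compose[of R P] by (simp add: linear_conv_bounded_linear o_def)
  have contr: "norm (P (R x)) \<le> norm (R x)" "norm (R x) \<le> norm x" for x
    using orth_projection_norm_le P R by blast+
  show ?thesis
  proof
    assume "onorm (\<lambda>x. P (R x)) = 1"
    with onorm_attained[OF lin] obtain x where x: "norm x = 1" "norm (P (R x)) = 1"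
      by auto
    then have "norm (R x) = norm x"
      using contr[of x] by simp
    then have "R x = x"
      by (rule orth_projection_norm_eq_imp_fixed[OF R])
    moreover have "P x = x"
      using x \<open>R x = x\<close> by (intro orth_projection_norm_eq_imp_fixed[OF P]) simp
    ultimately show "\<exists>x. x \<noteq> 0 \<and> P x = x \<and> R x = x"
      using x by (intro exI[of _ x]) auto
  next
    assume "\<exists>x. x \<noteq> 0 \<and> P x = x \<and> R x = x"
    then obtain x where x: "x \<noteq> 0" "P x = x" "R x = x"
      by blast
    have "onorm (\<lambda>x. P (R x)) \<le> 1"
      using order_trans[OF contr] by (intro onorm_bound) simp_all
    moreover have "1 * norm x \<le> onorm (\<lambda>x. P (R x)) * norm x"
      using onorm[OF lin, of x] x by simp
    then have "1 \<le> onorm (\<lambda>x. P (R x))"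
      using x by simp
    ultimately show "onorm (\<lambda>x. P (R x)) = 1"
      by simp
  qed
qed

section \<open>Conjugate transposes, diagonal and unitary matrices\<close>

lemma conj_transpose_nth [simp]: "conj_transpose A $ i $ j = cnj (A $ j $ i)"
  by (simp add: conj_transpose_def transpose_def map_matrix_def)

lemma conj_transpose_conj_transpose [simp]: "conj_transpose (conj_transpose A) = A"
  by (simp add: vec_eq_iff)

lemma conj_transpose_mult:
  "conj_transpose (A ** B) = conj_transpose B ** conj_transpose A"
  by (simp add: vec_eq_iff matrix_matrix_mult_def mult.commute)

lemma conj_transpose_diag_matrix: "conj_transpose (diag_matrix d) = diag_matrix (\<lambda>i. cnj (d i))"
  by (auto simp: vec_eq_iff diag_matrix_def)

lemma diag_matrix_mult: "diag_matrix c ** diag_matrix d = diag_matrix (\<lambda>i. c i * d i)"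
proof -
  have "(if i = k then c i else 0) * (if k = j then d k else 0)
      = (if k = i then if i = j then c i * d i else 0 else 0)" for i j k
    by auto
  then show ?thesis
    by (simp add: vec_eq_iff diag_matrix_def matrix_matrix_mult_def)
qed

lemma diag_matrix_eq_mat_1_iff: "diag_matrix d = mat 1 \<longleftrightarrow> (\<forall>i. d i = 1)"
  by (auto simp: vec_eq_iff diag_matrix_def mat_def)

lemma unitary_conj_transpose: "unitary_matrix A \<Longrightarrow> unitary_matrix (conj_transpose A)"
  by (simp add: unitary_matrix_def)

lemma unitary_mult:
  assumes "unitary_matrix A" and "unitary_matrix B"
  shows "unitary_matrix (A ** B)"
proof -
  have "conj_transpose (A ** B) ** (A ** B) = conj_transpose B ** (conj_transpose A ** A) ** B"
    by (simp add: conj_transpose_mult matrix_mul_assoc)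
  moreover have "(A ** B) ** conj_transpose (A ** B) = A ** (B ** conj_transpose B) ** conj_transpose A"
    by (simp add: conj_transpose_mult matrix_mul_assoc)
  ultimately show ?thesis
    using assms by (simp add: unitary_matrix_def)
qed

lemma unitary_diag_matrix_iff: "unitary_matrix (diag_matrix d) \<longleftrightarrow> (\<forall>i. cmod (d i) = 1)"
proof -
  have "cnj z * z = 1 \<longleftrightarrow> cmod z = 1" for z
  proof -
    have "cnj z * z = complex_of_real ((cmod z)\<^sup>2)"
      by (simp only: complex_norm_square mult.commute)
    then have "cnj z * z = 1 \<longleftrightarrow> (cmod z)\<^sup>2 = 1"
      by (simp only: of_real_eq_1_iff)
    then show ?thesis
      using norm_ge_zero[of z] by (auto simp: power2_eq_1_iff)
  qed
  then show ?thesis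
    by (simp add: unitary_matrix_def conj_transpose_diag_matrix diag_matrix_mult
        diag_matrix_eq_mat_1_iff mult.commute)
qed

lemma inner_conj_transpose:
  fixes A :: "complex^'n^'m"
  shows "(A *v x) \<bullet> y = x \<bullet> (conj_transpose A *v y)"
proof -
  have "(A *v x) \<bullet> y = (\<Sum>i\<in>UNIV. \<Sum>j\<in>UNIV. (A $ i $ j * x $ j) \<bullet> (y $ i))"
    by (simp add: inner_vec_def matrix_vector_mult_def inner_sum_left)
  also have "\<dots> = (\<Sum>j\<in>UNIV. \<Sum>i\<in>UNIV. (A $ i $ j * x $ j) \<bullet> (y $ i))"
    by (rule sum.swap)
  also have "\<dots> = (\<Sum>j\<in>UNIV. \<Sum>i\<in>UNIV. (x $ j) \<bullet> (cnj (A $ i $ j) * y $ i))"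
    by (simp add: inner_complex_def algebra_simps)
  also have "\<dots> = x \<bullet> (conj_transpose A *v y)"
    by (simp add: inner_vec_def matrix_vector_mult_def inner_sum_right)
  finally show ?thesis .
qed

lemma orth_projection_matrixI:
  fixes A :: "complex^'n^'n"
  assumes "conj_transpose A = A" and "A ** A = A"
  shows "orth_projection (\<lambda>x. A *v x)"
proof -
  have "linear (\<lambda>x. A *v x)"
    by (intro linearI) (simp_all add: vec_eq_iff matrix_vector_mult_def
        scaleR_sum_right distrib_left sum.distrib)
  then show ?thesis
    using assms inner_conj_transpose[of A]
    by (simp add: orth_projection_def matrix_vector_mul_assoc)
qed

section \<open>The limiting operators are orthogonal projections\<close>

lemma conj_transpose_diag_indicator:
  "conj_transpose (diag_matrix (indicator V)) = diag_matrix (indicator V)"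
  by (auto simp: vec_eq_iff diag_matrix_def indicator_def)

lemma diag_indicator_idem:
  "diag_matrix (indicator V) ** diag_matrix (indicator V) = diag_matrix (indicator V)"
  by (auto simp: diag_matrix_mult indicator_def intro!: arg_cong[of _ _ diag_matrix])

lemma orth_projection_vertex_limiting: "orth_projection (\<lambda>x. vertex_limiting V *v x)"
  unfolding vertex_limiting_def
  by (intro orth_projection_matrixI conj_transpose_diag_indicator diag_indicator_idem)

lemma unitary_eigenvalue_modulus:
  assumes "unitary_matrix A" and "unitary_diagonalization A Q l"
  shows "cmod (l i) = 1"
proof -
  have Q: "unitary_matrix Q" and A: "A = Q ** diag_matrix l ** conj_transpose Q"
    using assms(2) by (auto simp: unitary_diagonalization_def)
  have "conj_transpose Q ** A ** Q
      = (conj_transpose Q ** Q) ** diag_matrix l ** (conj_transpose Q ** Q)"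
    by (simp add: A matrix_mul_assoc)
  also have "\<dots> = diag_matrix l"
    using Q by (simp add: unitary_matrix_def)
  finally have "unitary_matrix (diag_matrix l)"
    using unitary_mult[OF unitary_mult[OF unitary_conj_transpose[OF Q] assms(1)] Q] by simp
  then show ?thesis
    by (simp add: unitary_diag_matrix_iff)
qed

lemma cmod_powr_real_unit_circle:
  assumes "cmod z = 1"
  shows "cmod (z powr complex_of_real a) = 1"
proof -
  have "z \<noteq> 0"
    using assms by auto
  then show ?thesis
    using assms by (simp add: powr_def)
qed

text \<open>On the unit circle conjugation is inversion, so this holds for principal values
  even on the branch cut, at \<open>z = -1\<close>.\<close>

lemma cnj_powr_real_unit_circle:
  assumes "cmod z = 1"
  shows "cnj (z powr complex_of_real a) = z powr complex_of_real (- a)"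
proof -
  have "z powr complex_of_real a * cnj (z powr complex_of_real a) = 1"
    using cmod_powr_real_unit_circle[OF assms, of a]
    by (simp only: complex_norm_square[symmetric]) simp
  then show ?thesis
    by (simp only: of_real_minus powr_minus inverse_unique)
qed

lemma unitary_gfrft:
  assumes "unitary_matrix Q" and "\<And>i. cmod (l i) = 1"
  shows "unitary_matrix (gfrft Q l \<alpha>)"
  unfolding gfrft_def using assms
  by (intro unitary_mult unitary_conj_transpose)
    (auto simp: unitary_diag_matrix_iff cmod_powr_real_unit_circle)

lemma gfrft_uminus:
  assumes "\<And>i. cmod (l i) = 1"
  shows "gfrft Q l (- \<alpha>) = conj_transpose (gfrft Q l \<alpha>)"
  unfolding gfrft_def conj_transpose_mult conj_transpose_diag_matrix
    conj_transpose_conj_transpose matrix_mul_assoc cnj_powr_real_unit_circle[OF assms] ..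

lemma orth_projection_spectral_limiting:
  assumes "unitary_matrix Q" and "\<And>i. cmod (l i) = 1"
  shows "orth_projection (\<lambda>x. spectral_limiting Q l \<alpha> W *v x)"
proof -
  define G where "G = gfrft Q l \<alpha>"
  define \<Sigma> :: "complex^'a^'a" where "\<Sigma> = diag_matrix (indicator W)"
  have B: "spectral_limiting Q l \<alpha> W = conj_transpose G ** \<Sigma> ** G"
    using gfrft_uminus[of l, OF assms(2)] by (simp add: spectral_limiting_def G_def \<Sigma>_def)
  have G: "G ** conj_transpose G = mat 1"
    using unitary_gfrft[OF assms] by (simp add: unitary_matrix_def G_def)
  show ?thesis
    unfolding B
  proof (rule orth_projection_matrixI)
    show "conj_transpose (conj_transpose G ** \<Sigma> ** G) = conj_transpose G ** \<Sigma> ** G"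
      by (simp add: conj_transpose_mult \<Sigma>_def conj_transpose_diag_indicator matrix_mul_assoc)
    have "(conj_transpose G ** \<Sigma> ** G) ** (conj_transpose G ** \<Sigma> ** G)
        = conj_transpose G ** \<Sigma> ** (G ** conj_transpose G) ** \<Sigma> ** G"
      by (simp add: matrix_mul_assoc)
    also have "\<dots> = conj_transpose G ** (\<Sigma> ** \<Sigma>) ** G"
      by (simp add: G matrix_mul_assoc)
    also have "\<dots> = conj_transpose G ** \<Sigma> ** G"
      by (simp add: \<Sigma>_def diag_indicator_idem)
    finally show "(conj_transpose G ** \<Sigma> ** G) ** (conj_transpose G ** \<Sigma> ** G)
        = conj_transpose G ** \<Sigma> ** G" .
  qed
qed

section \<open>Perfect localization\<close>

theorem theorem1:
  fixes S U Q :: "complex^('n::{finite,linorder})^('n::{finite,linorder})"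
    and \<delta> :: "'n \<Rightarrow> real" and l :: "'n \<Rightarrow> complex" and \<alpha> :: real
    and V W :: "'n set"
  assumes "shift_eigendecomposition S U \<delta>"
    and "unitary_diagonalization (conj_transpose U) Q l"
  shows "(\<exists>x. x \<noteq> 0 \<and> perfectly_localized Q l \<alpha> V W x) \<longleftrightarrow>
    (spectral_norm (spectral_limiting Q l \<alpha> W ** vertex_limiting V) =
       spectral_norm (vertex_limiting V ** spectral_limiting Q l \<alpha> W) \<and>
     spectral_norm (vertex_limiting V ** spectral_limiting Q l \<alpha> W) = 1)"
proof -
  define D where "D = (\<lambda>x. vertex_limiting V *v x)"
  define B where "B = (\<lambda>x. spectral_limiting Q l \<alpha> W *v x)"
  have "unitary_matrix (conj_transpose U)"
    using assms(1) by (simp add: shift_eigendecomposition_def unitary_conj_transpose)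
  then have "cmod (l i) = 1" for i
    using assms(2) by (rule unitary_eigenvalue_modulus)
  moreover have "unitary_matrix Q"
    using assms(2) by (simp add: unitary_diagonalization_def)
  ultimately have B: "orth_projection B"
    unfolding B_def by (intro orth_projection_spectral_limiting)
  have D: "orth_projection D"
    unfolding D_def by (rule orth_projection_vertex_limiting)
  have "spectral_norm (spectral_limiting Q l \<alpha> W ** vertex_limiting V) = onorm (\<lambda>x. B (D x))"
    "spectral_norm (vertex_limiting V ** spectral_limiting Q l \<alpha> W) = onorm (\<lambda>x. D (B x))"
    by (simp_all add: spectral_norm_def B_def D_def matrix_vector_mul_assoc)
  moreover have "perfectly_localized Q l \<alpha> V W x \<longleftrightarrow> D x = x \<and> B x = x" for x
    by (simp add: perfectly_localized_def vertex_limited_signals_def bandlimited_signals_def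
        B_def D_def)
  ultimately show ?thesis
    using onorm_comp_orth_projections_eq_1_iff[OF B D] onorm_comp_orth_projections_eq_1_iff[OF D B]
    by auto
qed

end
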